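(* Let $E$ be a finitely irreducible infinite countable set (with respect to a matrix $A:E\times E\to\{0,1\}$). Let $F\subset E$ be a finitely irreducible subset of $E$ and let $\Lambda$ be a nonempty set witnessing finite irreducibility for $F$. Let $\alpha>0$. Then for every $a\in E$ and every $\alpha$-Hölder function $f:E_A^{\mathbb N}\to\mathbb R$ such that $P_F^\sigma(f)<0$, $$e^{P^\sigma_{F\cup\{a\}}(f)}\le e^{P^\sigma_F(f)}+\frac{\sharp\Lambda\,e^{L(f)}}{\kappa_\Lambda(f)}\,e^{\sup f|_{[a]}}.$$
   Context: $\mathbb N=\{1,2,\dots\}$. $E$ is a countable alphabet and $A:E\times E\to\{0,1\}$ a matrix. For $F\subset E$: $F_A^n$ ($n\ge1$) is the set of words $\omega\in F^n$ with $A_{\omega_k\omega_{k+1}}=1$ for $1\le k\le n-1$; $F_A^0=\{\emptyset\}$ (empty word); $F_A^*=\bigcup_{n\ge0}F_A^n$; $F_A^{\mathbb N}$ is the set of $\omega\in F^{\mathbb N}$ with $A_{\omega_k\omega_{k+1}}=1$ for all $k$. $|\omega|$ is the length of a finite word. $\sigma:E_A^{\mathbb N}\to E_A^{\mathbb N}$ is the left shift. For $\omega\in E_A^*$, $[\omega]=\{\tau\in E_A^{\mathbb N}:\tau|_{|\omega|}=\omega\}$, and for $\omega\in F_A^*$, $[\omega]_F=\{\tau\in F_A^{\mathbb N}:\tau|_{|\omega|}=\omega\}$. $\omega\wedge\tau$ is the longest common initial block of $\omega,\tau$. A finite set $\Lambda\subset F_A^*$ witnesses finite irreducibility for $F$ if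 for all $i,j\in F$ there is $\omega\in\Lambda$ with $i\omega j\in F_A^*$; $F$ is finitely irreducible if such a $\Lambda$ exists (likewise for $F=E$). $\sharp\Lambda$ is the cardinality of $\Lambda$. $f:E_A^{\mathbb N}\to\mathbb R$ is $\alpha$-Hölder if $\sup_{n\ge1}\sup\{|f(\omega)-f(\tau)|e^{\alpha(n-1)}:\omega,\tau\in E_A^{\mathbb N},\ |\omega\wedge\tau|\ge n\}<\infty$. $S_nf=\sum_{j=0}^{n-1}f\circ\sigma^j$ (so $S_0f=0$). Topological pressure: $Z_n(F,f)=\sum_{\omega\in F_A^n}\exp\left(\sup_{\tau\in[\omega]_F}S_nf(\tau)\right)$ (a term with $[\omega]_F=\emptyset$ being $0$), and $P_F^\sigma(f)=\lim_{n\to\infty}\frac1n\log Z_n(F,f)=\inf_n\frac1n\log Z_n(F,f)\in[-\infty,+\infty]$. $L(f)$ is the infimum of all $M>0$ such that $|S_nf(\rho\omega)-S_nf(\rho\tau)|\le M$ for all $n\in\mathbb N$, $\rho\in E_A^n$, $\omega,\tau\in E_A^{\mathbb N}$ with $\rho\omega,\rho\tau\in E_A^{\mathbb N}$ (finite for Hölder $f$). $\kappa_\Lambda(f)=\min_{\lambda\in\Lambda}\inf_{[\lambda]}e^{S_{|\lambda|}f}$. *)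

theory Defs
  imports "HOL-Analysis.Analysis" "HOL-Library.Stream"
begin

text \<open>
  The alphabet \<open>E\<close> and its subsets are sets over a type \<open>'e\<close>, the matrix is a function
  \<open>A :: 'e \<Rightarrow> 'e \<Rightarrow> nat\<close> of which only the values on \<open>E \<times> E\<close> matter. Finite words are lists and
  infinite words are streams; positions are counted from 0. A function on the set of admissible
  infinite words over \<open>E\<close> is a function on all streams of which only the values on that set are used.
\<close>

text \<open>Admissible words over \<open>F\<close> of length \<open>n\<close>, of finite length, and of infinite length. The case
  \<open>n = 0\<close> gives \<open>{[]}\<close>.\<close>

definition words :: "('e \<Rightarrow> 'e \<Rightarrow> nat) \<Rightarrow> 'e set \<Rightarrow> nat \<Rightarrow> 'e list set" where
  "words A F n =
     {w. length w = n \<and> set w \<subseteq> F \<and> (\<forall>k. Suc k < n \<longrightarrow> A (w ! k) (w ! Suc k) = 1)}"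

definition fin_words :: "('e \<Rightarrow> 'e \<Rightarrow> nat) \<Rightarrow> 'e set \<Rightarrow> 'e list set" where
  "fin_words A F = (\<Union>n. words A F n)"

definition inf_words :: "('e \<Rightarrow> 'e \<Rightarrow> nat) \<Rightarrow> 'e set \<Rightarrow> 'e stream set" where
  "inf_words A F = {\<tau> \<in> streams F. \<forall>k. A (\<tau> !! k) (\<tau> !! Suc k) = 1}"

definition cylinder :: "('e \<Rightarrow> 'e \<Rightarrow> nat) \<Rightarrow> 'e set \<Rightarrow> 'e list \<Rightarrow> 'e stream set" where
  "cylinder A F w = {\<tau> \<in> inf_words A F. stake (length w) \<tau> = w}"

definition meet_length :: "'e stream \<Rightarrow> 'e stream \<Rightarrow> enat" where
  "meet_length \<omega> \<tau> = (SUP n \<in> {n. stake n \<omega> = stake n \<tau>}. enat n)"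

definition witnesses_irreducibility ::
    "('e \<Rightarrow> 'e \<Rightarrow> nat) \<Rightarrow> 'e set \<Rightarrow> 'e list set \<Rightarrow> bool" where
  "witnesses_irreducibility A F \<Lambda> \<longleftrightarrow>
     finite \<Lambda> \<and> \<Lambda> \<subseteq> fin_words A F \<and>
     (\<forall>i\<in>F. \<forall>j\<in>F. \<exists>w\<in>\<Lambda>. [i] @ w @ [j] \<in> fin_words A F)"

definition finitely_irreducible :: "('e \<Rightarrow> 'e \<Rightarrow> nat) \<Rightarrow> 'e set \<Rightarrow> bool" where
  "finitely_irreducible A F \<longleftrightarrow> (\<exists>\<Lambda>. witnesses_irreducibility A F \<Lambda>)"

text \<open>Finiteness of the double supremum of the nonnegative quantities in the definition of
  Hoelder continuity is boundedness of the set of all of them.\<close>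

definition hoelder :: "('e \<Rightarrow> 'e \<Rightarrow> nat) \<Rightarrow> 'e set \<Rightarrow> real \<Rightarrow> ('e stream \<Rightarrow> real) \<Rightarrow> bool" where
  "hoelder A E \<alpha> f \<longleftrightarrow>
     bdd_above {\<bar>f \<omega> - f \<tau>\<bar> * exp (\<alpha> * (real n - 1)) | n \<omega> \<tau>.
       n \<ge> 1 \<and> \<omega> \<in> inf_words A E \<and> \<tau> \<in> inf_words A E \<and> meet_length \<omega> \<tau> \<ge> enat n}"

definition birkhoff_sum :: "('e stream \<Rightarrow> real) \<Rightarrow> nat \<Rightarrow> 'e stream \<Rightarrow> real" where
  "birkhoff_sum f n \<tau> = (\<Sum>j<n. f (sdrop j \<tau>))"

text \<open>The exponential and the logarithm as mutually inverse maps between \<open>[-\<infinity>, \<infinity>]\<close> and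
  \<open>[0, \<infinity>]\<close>.\<close>

definition eexp :: "ereal \<Rightarrow> ennreal" where
  "eexp x = (if x = -\<infinity> then 0 else if x = \<infinity> then \<infinity> else ennreal (exp (real_of_ereal x)))"

definition elog :: "ennreal \<Rightarrow> ereal" where
  "elog x = (if x = 0 then -\<infinity> else if x = \<infinity> then \<infinity> else ereal (ln (enn2real x)))"

text \<open>The supremum is taken in \<open>ereal\<close>, so an empty cylinder contributes \<open>eexp (-\<infinity>) = 0\<close>.\<close>

definition partition_fun ::
    "('e \<Rightarrow> 'e \<Rightarrow> nat) \<Rightarrow> 'e set \<Rightarrow> ('e stream \<Rightarrow> real) \<Rightarrow> nat \<Rightarrow> ennreal" where
  "partition_fun A F f n =
     (\<Sum>\<^sub>\<infinity>w\<in>words A F n. eexp (SUP \<tau>\<in>cylinder A F w. ereal (birkhoff_sum f n \<tau>)))"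

definition pressure :: "('e \<Rightarrow> 'e \<Rightarrow> nat) \<Rightarrow> 'e set \<Rightarrow> ('e stream \<Rightarrow> real) \<Rightarrow> ereal" where
  "pressure A F f = lim (\<lambda>n. ereal (1 / real n) * elog (partition_fun A F f n))"

definition distortion :: "('e \<Rightarrow> 'e \<Rightarrow> nat) \<Rightarrow> 'e set \<Rightarrow> ('e stream \<Rightarrow> real) \<Rightarrow> real" where
  "distortion A E f = Inf {M. M > 0 \<and>
     (\<forall>n\<ge>1. \<forall>\<rho>\<in>words A E n. \<forall>\<omega>\<in>inf_words A E. \<forall>\<tau>\<in>inf_words A E.
        \<rho> @- \<omega> \<in> inf_words A E \<longrightarrow> \<rho> @- \<tau> \<in> inf_words A E \<longrightarrow>
        \<bar>birkhoff_sum f n (\<rho> @- \<omega>) - birkhoff_sum f n (\<rho> @- \<tau>)\<bar> \<le> M)}"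

definition kappa ::
    "('e \<Rightarrow> 'e \<Rightarrow> nat) \<Rightarrow> 'e set \<Rightarrow> 'e list set \<Rightarrow> ('e stream \<Rightarrow> real) \<Rightarrow> real" where
  "kappa A E \<Lambda> f =
     Min ((\<lambda>w. INF \<tau>\<in>cylinder A E w. exp (birkhoff_sum f (length w) \<tau>)) ` \<Lambda>)"

end

theory Submission
  imports Defs
begin

text \<open>
  Write \<open>W\<^sub>m\<close> for the sum of \<open>sup exp S\<^sub>m f\<close> over the cylinders (taken in the full shift over \<open>E\<close>) of the words of
  length \<open>m\<close> over \<open>F\<close>, put \<open>K = \<sharp>\<Lambda> e\<^sup>L / \<kappa>\<close>, and let \<open>exp P\<^sub>F < q < 1\<close>. The series
  \<open>\<Phi> = \<Sum>\<^sub>v sup exp S f q\<^sup>-\<^sup>|\<^sup>v\<^sup>|\<close> over the nonempty words over \<open>F\<close> converges. Sending \<open>(u, v)\<close> to \<open>u l v\<close> with a linking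
  word \<open>l \<in> \<Lambda>\<close> is at most \<open>\<sharp>\<Lambda>\<close>-to-one, and \<open>q \<le> 1\<close> makes the factor \<open>q\<^sup>-\<^sup>|\<^sup>l\<^sup>|\<close> harmless, so
  \<open>\<kappa> e\<^sup>-\<^sup>L q\<^sup>-\<^sup>m W\<^sub>m \<Phi> \<le> \<sharp>\<Lambda> \<Phi>\<close>; cancelling \<open>\<Phi>\<close> gives \<open>W\<^sub>m \<le> K q\<^sup>m\<close>, including \<open>m = 0\<close>.
  Splitting a word over \<open>F \<union> {a}\<close> at its first letter outside \<open>F\<close> turns this, by induction on \<open>n\<close>, into the
  bound \<open>K (q + K exp (sup f|[a]))\<^sup>n\<close> for the partition function of \<open>F \<union> {a}\<close>. Take \<open>n\<close>-th roots, then let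
  \<open>q\<close> tend to \<open>exp P\<^sub>F\<close>.
\<close>

section \<open>Extended exponential, roots and sums\<close>

text \<open>\<open>eexp\<close> and \<open>elog\<close> form a Galois connection. Monotonicity and
  the passage of suprema through \<open>eexp\<close> follow from this without further case
  distinctions.\<close>

lemma ereal_le_elog_iff: "x \<le> elog y \<longleftrightarrow> eexp x \<le> y"
proof (cases y)
  case (real r)
  show ?thesis
  proof (cases "r = 0")
    case True
    then show ?thesis using real by (cases x) (auto simp: elog_def eexp_def)
  next
    case False
    then have "r > 0" using real by simp
    then show ?thesis using real
      by (cases x) (auto simp: elog_def eexp_def ln_ge_iff ennreal_le_iff2 not_le top_unique)
  qed
next
  case top
  then show ?thesis by (auto simp: elog_def)
qed

lemma eexp_mono: "x \<le> y \<Longrightarrow> eexp x \<le> eexp y"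
  by (metis ereal_le_elog_iff order.refl order.trans)

lemma eexp_elog: "eexp (elog y) = y"
  by (cases y) (auto simp: elog_def eexp_def)

lemma eexp_SUP: "eexp (SUP x\<in>X. ereal (g x)) = (SUP x\<in>X. ennreal (exp (g x)))"
proof (rule antisym)
  have "ereal (g x) \<le> elog (SUP x\<in>X. ennreal (exp (g x)))" if "x \<in> X" for x
    unfolding ereal_le_elog_iff using that by (auto simp: eexp_def intro: SUP_upper)
  then show "eexp (SUP x\<in>X. ereal (g x)) \<le> (SUP x\<in>X. ennreal (exp (g x)))"
    unfolding ereal_le_elog_iff[symmetric] by (rule SUP_least)
  have "ennreal (exp (g x)) \<le> eexp (SUP x\<in>X. ereal (g x))" if "x \<in> X" for x
    using eexp_mono[OF SUP_upper[OF that, of "\<lambda>x. ereal (g x)"]] by (simp add: eexp_def)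
  then show "(SUP x\<in>X. ennreal (exp (g x))) \<le> eexp (SUP x\<in>X. ereal (g x))"
    by (rule SUP_least)
qed

text \<open>Continuity includes the limit 0, where \<open>elog\<close> is minus infinity; this
  covers pressure equal to minus infinity.\<close>

lemma tendsto_elog_ennreal:
  assumes "x \<longlonglongrightarrow> r"
  shows "(\<lambda>n. elog (ennreal (x n))) \<longlonglongrightarrow> elog (ennreal r)"
proof (cases "r > 0")
  case True
  have "(\<lambda>n. ereal (ln (x n))) \<longlonglongrightarrow> ereal (ln r)"
    using assms True by (intro tendsto_intros) auto
  moreover have "\<forall>\<^sub>F n in sequentially. ereal (ln (x n)) = elog (ennreal (x n))"
    using order_tendstoD(1)[OF assms True] by eventually_elim (auto simp: elog_def)
  ultimately show ?thesis
    using True by (auto simp: elog_def intro: Lim_transform_eventually)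
next
  case False
  have "\<forall>\<^sub>F n in sequentially. elog (ennreal (x n)) < ereal B" for B
  proof -
    have "\<forall>\<^sub>F n in sequentially. x n < exp B"
      using False exp_gt_zero[of B] by (intro order_tendstoD(2)[OF assms]) linarith
    then show ?thesis
    proof eventually_elim
      case (elim n)
      then have "x n > 0 \<Longrightarrow> ln (x n) < B" by (metis ln_exp ln_less_cancel_iff exp_gt_zero)
      then show ?case by (auto simp: elog_def ennreal_eq_0_iff not_le)
    qed
  qed
  then show ?thesis
    using False by (simp add: elog_def ennreal_neg tendsto_MInfty)
qed

section \<open>Roots of submultiplicative sequences\<close>

text \<open>Fekete's lemma in multiplicative form: the limit is the infimum of the roots. If the
  \<open>m\<close>-th root lies below \<open>b'\<close>, writing \<open>n = m * k + s\<close> with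
  \<open>s < m\<close> bounds \<open>z n\<close> by a constant times \<open>b' ^ n\<close>.\<close>

lemma submultiplicative_root_convergent:
  fixes z :: "nat \<Rightarrow> real"
  assumes nonneg: "\<And>n. z n \<ge> 0" and sub: "\<And>n m. z (n + m) \<le> z n * z m"
  obtains r where "r \<ge> 0" "(\<lambda>n. root n (z n)) \<longlonglongrightarrow> r"
proof
  define r where "r = (INF n\<in>{1..}. root n (z n))"
  have bdd: "bdd_below ((\<lambda>n. root n (z n)) ` {1..})"
    by (rule bdd_belowI2[of _ 0]) (simp add: nonneg)
  show "r \<ge> 0"
    unfolding r_def by (rule cINF_greatest) (auto simp: nonneg)
  show "(\<lambda>n. root n (z n)) \<longlonglongrightarrow> r"
  proof (rule order_tendstoI)
    fix b assume "b < r"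
    have "\<forall>\<^sub>F n in sequentially. root n (z n) \<ge> r"
      using eventually_ge_at_top[of 1]
      by eventually_elim (use cINF_lower[OF bdd] in \<open>simp add: r_def\<close>)
    then show "\<forall>\<^sub>F n in sequentially. b < root n (z n)"
      by eventually_elim (use \<open>b < r\<close> in auto)
  next
    fix b assume "r < b"
    then obtain b' where b': "r < b'" "b' < b" using dense by blast
    then have "b' > 0" using \<open>r \<ge> 0\<close> by simp
    obtain m where m: "m \<ge> 1" "root m (z m) < b'"
      using b'(1) bdd unfolding r_def by (subst (asm) cINF_less_iff) auto
    then have zm: "z m \<le> b' ^ m"
      using power_mono[of "root m (z m)" b' m] by (simp add: nonneg)
    \<comment> \<open>\<open>C\<close> dominates \<open>z s / b' ^ s\<close> for all remainders
      \<open>s < m\<close>. The added 1 makes it positive, so that \<open>root n C\<close> tends to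
      1.\<close>
    define C where "C = (\<Sum>s<m. z s / b' ^ s) + 1"
    have "C > 0"
      unfolding C_def using \<open>b' > 0\<close> by (intro add_nonneg_pos sum_nonneg) (auto simp: nonneg)
    have zs: "z s \<le> C * b' ^ s" if "s < m" for s
    proof -
      have "z s / b' ^ s \<le> (\<Sum>s<m. z s / b' ^ s)"
        using \<open>b' > 0\<close> that by (intro member_le_sum) (auto simp: nonneg)
      then have "z s / b' ^ s \<le> C"
        unfolding C_def by linarith
      then show ?thesis
        using \<open>b' > 0\<close> by (simp add: field_simps)
    qed
    have zk: "z (m * k + s) \<le> C * b' ^ (m * k + s)" if "s < m" for k s
    proof (induction k)
      case (Suc k)
      have "z (m * Suc k + s) \<le> z m * z (m * k + s)"
        using sub[of m "m * k + s"] by (simp add: algebra_simps)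
      also have "\<dots> \<le> b' ^ m * (C * b' ^ (m * k + s))"
        using zm Suc \<open>b' > 0\<close> by (intro mult_mono) (auto simp: nonneg)
      finally show ?case by (simp add: algebra_simps power_add)
    qed (use zs that in auto)
    have "root n (z n) \<le> root n C * b'" if "n \<ge> 1" for n
    proof -
      have "z n \<le> C * b' ^ n"
        using zk[of "n mod m" "n div m"] m(1) by simp
      then have "root n (z n) \<le> root n (C * b' ^ n)"
        using that by (intro real_root_le_mono) auto
      also have "\<dots> = root n C * b'"
        using that \<open>b' > 0\<close> by (simp add: real_root_mult real_root_power_cancel)
      finally show ?thesis .
    qed
    then have le: "\<forall>\<^sub>F n in sequentially. root n (z n) \<le> root n C * b'"
      using eventually_ge_at_top[of 1] by (rule eventually_mono[rotated])
    have "(\<lambda>n. root n C * b') \<longlonglongrightarrow> 1 * b'"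
      by (intro tendsto_intros LIMSEQ_root_const \<open>C > 0\<close>)
    then have "\<forall>\<^sub>F n in sequentially. root n C * b' < b"
      using b' by (intro order_tendstoD) auto
    with le show "\<forall>\<^sub>F n in sequentially. root n (z n) < b"
      by eventually_elim auto
  qed
qed

lemma root_tendsto_imp_geometric_bound:
  fixes z :: "nat \<Rightarrow> real"
  assumes "\<And>n. z n \<ge> 0" "(\<lambda>n. root n (z n)) \<longlonglongrightarrow> r" "r < q" "q > 0"
  obtains C where "C \<ge> 0" "\<And>n. z n \<le> C * q ^ n"
proof -
  have "\<forall>\<^sub>F n in sequentially. root n (z n) < q"
    using assms(2,3) by (rule order_tendstoD)
  then obtain N where N: "\<And>n. n \<ge> N \<Longrightarrow> root n (z n) < q"
    by (auto simp: eventually_sequentially)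
  define C where "C = (\<Sum>s\<le>N. z s / q ^ s) + 1"
  have nonneg: "(\<Sum>s\<le>N. z s / q ^ s) \<ge> 0"
    using assms by (intro sum_nonneg) auto
  have "z n \<le> C * q ^ n" for n
  proof (cases "n \<le> N")
    case True
    have "z n / q ^ n \<le> (\<Sum>s\<le>N. z s / q ^ s)"
      using assms True by (intro member_le_sum) auto
    then have "z n / q ^ n \<le> C" by (simp add: C_def)
    then show ?thesis using assms(4) by (simp add: field_simps)
  next
    case False
    then have "z n = root n (z n) ^ n" using assms(1) by simp
    also have "\<dots> \<le> q ^ n"
      using N[of n] False assms(1) by (intro power_mono) auto
    also have "\<dots> \<le> C * q ^ n"
      using nonneg assms(4) by (simp add: C_def)
    finally show ?thesis .
  qed
  with nonneg that[of C] show ?thesis by (simp add: C_def)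
qed

section \<open>Infinite sums in \<open>ennreal\<close> through their finite subsums\<close>

lemma infsum_ennreal_finite_le: "finite X \<Longrightarrow> X \<subseteq> U \<Longrightarrow> sum g X \<le> infsum g U" for g :: "'a \<Rightarrow> ennreal"
  by (subst nonneg_infsum_complete) (auto intro: SUP_upper)

lemma infsum_ennreal_leI:
  fixes g :: "'a \<Rightarrow> ennreal"
  assumes "\<And>X. finite X \<Longrightarrow> X \<subseteq> U \<Longrightarrow> sum g X \<le> b"
  shows "infsum g U \<le> b"
  using assms by (intro infsum_le_finite_sums nonneg_summable_on_complete) auto

lemma infsum_ennreal_mult_leI:
  fixes g :: "'a \<Rightarrow> ennreal"
  assumes "\<And>X. finite X \<Longrightarrow> X \<subseteq> U \<Longrightarrow> c * sum g X \<le> b"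
  shows "c * infsum g U \<le> b"
  using assms
  by (subst nonneg_infsum_complete) (auto simp: SUP_mult_left_ennreal intro: SUP_least)

lemma sum_image_le_infsum:
  fixes g :: "'b \<Rightarrow> ennreal"
  assumes "finite X" "inj_on p X" "p ` X \<subseteq> U"
  shows "(\<Sum>x\<in>X. g (p x)) \<le> infsum g U"
  using infsum_ennreal_finite_le[of "p ` X" U g] assms by (simp add: sum.reindex)

text \<open>This is how a sum over words is bounded by a product after each word is cut in two. Only
  the pair of pieces has to determine \<open>x\<close>; with \<open>g = 1\<close> the first sum
  counts the multiplicity of the map \<open>s\<close>.\<close>

lemma sum_prod_le_infsum_mult:
  fixes g :: "'b \<Rightarrow> ennreal" and h :: "'c \<Rightarrow> ennreal"
  assumes "finite X" "inj_on (\<lambda>x. (p x, s x)) X" "p ` X \<subseteq> U" "s ` X \<subseteq> V"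
  shows "(\<Sum>x\<in>X. g (p x) * h (s x)) \<le> infsum g U * infsum h V"
proof -
  have "(\<Sum>x\<in>X. g (p x) * h (s x)) = (\<Sum>(u, v)\<in>(\<lambda>x. (p x, s x)) ` X. g u * h v)"
    using assms(2) by (simp add: sum.reindex)
  also have "\<dots> \<le> (\<Sum>(u, v)\<in>p ` X \<times> s ` X. g u * h v)"
    using assms(1) by (intro sum_mono2) auto
  also have "\<dots> = sum g (p ` X) * sum h (s ` X)"
    by (simp add: sum_product sum.cartesian_product)
  also have "\<dots> \<le> infsum g U * infsum h V"
    using assms by (intro mult_mono infsum_ennreal_finite_le) auto
  finally show ?thesis .
qed

section \<open>Words, cylinders and their weights\<close>

lemma words_eq: "words A F n = {w. length w = n \<and> set w \<subseteq> F \<and> successively (\<lambda>x y. A x y = 1) w}"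
  by (auto simp: words_def successively_conv_nth)

lemma words_empty: "words A {} n = (if n = 0 then {[]} else {})"
  by (auto simp: words_eq)

lemma fin_words_eq: "fin_words A F = {w. set w \<subseteq> F \<and> successively (\<lambda>x y. A x y = 1) w}"
  by (auto simp: fin_words_def words_eq)

lemma words_iff_fin_words: "w \<in> words A F n \<longleftrightarrow> w \<in> fin_words A F \<and> length w = n"
  by (auto simp: words_eq fin_words_eq)

lemma fin_words_append:
  "u @ v \<in> fin_words A F \<longleftrightarrow> u \<in> fin_words A F \<and> v \<in> fin_words A F \<and>
     (u = [] \<or> v = [] \<or> A (last u) (hd v) = 1)"
  by (auto simp: fin_words_eq successively_append_iff)

lemma inf_words_SCons:
  "x ## \<tau> \<in> inf_words A F \<longleftrightarrow> x \<in> F \<and> \<tau> \<in> inf_words A F \<and> A x (shd \<tau>) = 1"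
proof -
  have "(\<forall>k. A ((x ## \<tau>) !! k) ((x ## \<tau>) !! Suc k) = 1) \<longleftrightarrow>
      A x (shd \<tau>) = 1 \<and> (\<forall>k. A (\<tau> !! k) (\<tau> !! Suc k) = 1)"
    by (metis not0_implies_Suc snth.simps(1,2) stream.sel)
  then show ?thesis
    by (auto simp: inf_words_def streams_Stream)
qed

lemma inf_words_shift:
  "w @- \<tau> \<in> inf_words A F \<longleftrightarrow>
     w \<in> fin_words A F \<and> \<tau> \<in> inf_words A F \<and> (w = [] \<or> A (last w) (shd \<tau>) = 1)"
proof (induction w)
  case (Cons x w)
  then show ?case
    by (cases w) (auto simp: inf_words_SCons fin_words_eq)
qed (simp add: fin_words_eq)

lemma inf_words_mono: "F \<subseteq> E \<Longrightarrow> inf_words A F \<subseteq> inf_words A E"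
  by (auto simp: inf_words_def intro: streams_mono)

lemma fin_words_mono: "F \<subseteq> E \<Longrightarrow> fin_words A F \<subseteq> fin_words A E"
  by (auto simp: fin_words_eq)

lemma sdrop_inf_words: "\<tau> \<in> inf_words A F \<Longrightarrow> sdrop n \<tau> \<in> inf_words A F"
  using inf_words_shift[of "stake n \<tau>" "sdrop n \<tau>"] by (simp add: stake_sdrop)

lemma stake_words: "\<tau> \<in> inf_words A F \<Longrightarrow> stake n \<tau> \<in> words A F n"
  using inf_words_shift[of "stake n \<tau>" "sdrop n \<tau>"] by (simp add: stake_sdrop words_iff_fin_words)

lemma cylinder_shift: "w @- \<tau> \<in> cylinder A F w \<longleftrightarrow> w @- \<tau> \<in> inf_words A F"
  by (simp add: cylinder_def stake_shift)

lemma cylinderE: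
  assumes "\<tau> \<in> cylinder A F w"
  obtains "\<tau> = w @- sdrop (length w) \<tau>" "\<tau> \<in> inf_words A F" "w \<in> fin_words A F"
  using assms stake_sdrop[of "length w" \<tau>] stake_words[of \<tau> A F "length w"]
  by (auto simp: cylinder_def words_iff_fin_words)

lemma cylinder_append:
  "\<tau> \<in> cylinder A F (u @ v) \<longleftrightarrow> \<tau> \<in> cylinder A F u \<and> sdrop (length u) \<tau> \<in> cylinder A F v"
  by (auto simp: cylinder_def sdrop_inf_words stake_add[symmetric] simp del: stake_add)

lemma birkhoff_sum_add:
  "birkhoff_sum f (n + m) \<tau> = birkhoff_sum f n \<tau> + birkhoff_sum f m (sdrop n \<tau>)"
  unfolding birkhoff_sum_def by (induction m) (auto simp: add.commute)

text \<open>The set argument is the alphabet of the infinite extensions of \<open>w\<close>. Weights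
  over \<open>F\<close> make up the partition function of \<open>F\<close>, while weights over
  \<open>E\<close> allow words over different subalphabets to be compared. An empty cylinder has
  weight 0.\<close>

definition cyl_weight ::
    "('e \<Rightarrow> 'e \<Rightarrow> nat) \<Rightarrow> 'e set \<Rightarrow> ('e stream \<Rightarrow> real) \<Rightarrow> 'e list \<Rightarrow> ennreal" where
  "cyl_weight A F f w = (SUP \<tau>\<in>cylinder A F w. ennreal (exp (birkhoff_sum f (length w) \<tau>)))"

lemma partition_fun_eq: "partition_fun A F f n = infsum (cyl_weight A F f) (words A F n)"
  unfolding partition_fun_def cyl_weight_def
  by (rule infsum_cong) (auto simp: eexp_SUP words_eq)

lemma cyl_weight_upper:
  "\<tau> \<in> cylinder A F w \<Longrightarrow> ennreal (exp (birkhoff_sum f (length w) \<tau>)) \<le> cyl_weight A F f w"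
  unfolding cyl_weight_def by (rule SUP_upper)

lemma cyl_weight_mono: "F \<subseteq> E \<Longrightarrow> cyl_weight A F f w \<le> cyl_weight A E f w"
  unfolding cyl_weight_def using inf_words_mono[of F E A]
  by (intro SUP_subset_mono) (auto simp: cylinder_def)

lemma cyl_weight_Nil_le: "cyl_weight A F f [] \<le> 1"
  unfolding cyl_weight_def by (rule SUP_least) (simp add: birkhoff_sum_def)

lemma cyl_weight_append_le:
  "cyl_weight A F f (u @ v) \<le> cyl_weight A F f u * cyl_weight A F f v"
  unfolding cyl_weight_def[of A F f "u @ v"]
proof (rule SUP_least)
  fix \<tau> assume "\<tau> \<in> cylinder A F (u @ v)"
  then have "\<tau> \<in> cylinder A F u" "sdrop (length u) \<tau> \<in> cylinder A F v"
    by (auto simp: cylinder_append)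
  then show "ennreal (exp (birkhoff_sum f (length (u @ v)) \<tau>)) \<le> cyl_weight A F f u * cyl_weight A F f v"
    by (auto simp: birkhoff_sum_add exp_add ennreal_mult intro!: mult_mono cyl_weight_upper)
qed

text \<open>Cutting after \<open>n\<close> letters is injective and leaves two admissible words. Not
  every pair of words need be composable, hence only an inequality.\<close>

lemma partition_fun_submultiplicative:
  "partition_fun A F f (n + m) \<le> partition_fun A F f n * partition_fun A F f m"
  unfolding partition_fun_eq
proof (rule infsum_ennreal_leI)
  fix X assume X: "finite X" "X \<subseteq> words A F (n + m)"
  have "sum (cyl_weight A F f) X \<le> (\<Sum>w\<in>X. cyl_weight A F f (take n w) * cyl_weight A F f (drop n w))"
    by (intro sum_mono) (metis append_take_drop_id cyl_weight_append_le)
  also have "\<dots> \<le> infsum (cyl_weight A F f) (words A F n) * infsum (cyl_weight A F f) (words A F m)"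
  proof (rule sum_prod_le_infsum_mult[OF X(1)])
    show "inj_on (\<lambda>w. (take n w, drop n w)) X"
      by (rule inj_onI) (metis append_take_drop_id prod.inject)
    have "take n w \<in> words A F n \<and> drop n w \<in> words A F m" if "w \<in> words A F (n + m)" for w
      using that fin_words_append[of "take n w" "drop n w"] by (auto simp: words_iff_fin_words)
    with X(2) show "take n ` X \<subseteq> words A F n" "drop n ` X \<subseteq> words A F m" by blast+
  qed
  finally show "sum (cyl_weight A F f) X \<le> \<dots>" .
qed

section \<open>Pressure as a limit of roots\<close>

text \<open>\<open>lim\<close> denotes the limit only once convergence is known. Finiteness makes
  the partition functions real, so Fekete's lemma applies to their roots, and \<open>elog\<close>
  carries the limit over.\<close>

lemma pressure_eq_elog:
  assumes fin: "\<And>n. partition_fun A F f n < \<infinity>"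
  obtains r where "r \<ge> 0" "pressure A F f = elog (ennreal r)"
    "(\<lambda>n. root n (enn2real (partition_fun A F f n))) \<longlonglongrightarrow> r"
proof -
  define z where "z = (\<lambda>n. enn2real (partition_fun A F f n))"
  have pz: "partition_fun A F f n = ennreal (z n)" for n
    using fin[of n] by (simp add: z_def)
  have nonneg: "z n \<ge> 0" for n
    by (simp add: z_def)
  have "z (n + m) \<le> z n * z m" for n m
  proof -
    have "ennreal (z (n + m)) \<le> ennreal (z n * z m)"
      using partition_fun_submultiplicative[of A F f n m] by (simp add: pz ennreal_mult nonneg)
    then show "z (n + m) \<le> z n * z m"
      by (simp add: nonneg ennreal_le_iff)
  qed
  with nonneg obtain r where r: "r \<ge> 0" "(\<lambda>n. root n (z n)) \<longlonglongrightarrow> r"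
    using submultiplicative_root_convergent by blast
  have "elog (ennreal (root n (z n))) = ereal (1 / real n) * elog (partition_fun A F f n)"
    if "n \<ge> 1" for n
  proof (cases "z n > 0")
    case True
    then show ?thesis using that
      by (simp add: elog_def pz ennreal_eq_0_iff ln_root)
  next
    case False
    then have "z n = 0" using nonneg[of n] by linarith
    then show ?thesis using that
      by (simp add: elog_def pz)
  qed
  then have "\<forall>\<^sub>F n in sequentially. elog (ennreal (root n (z n))) =
      ereal (1 / real n) * elog (partition_fun A F f n)"
    using eventually_ge_at_top[of 1] by (rule eventually_mono[rotated])
  with tendsto_elog_ennreal[OF r(2)] have
    "(\<lambda>n. ereal (1 / real n) * elog (partition_fun A F f n)) \<longlonglongrightarrow> elog (ennreal r)"
    by (rule Lim_transform_eventually)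
  then have "pressure A F f = elog (ennreal r)"
    unfolding pressure_def by (rule limI)
  with r that show ?thesis unfolding z_def by blast
qed

section \<open>Bounded distortion\<close>

text \<open>Two points of one cylinder still share \<open>length w - j\<close> letters after
  \<open>j\<close> shifts, so the differences of \<open>f\<close> are dominated by a geometric
  series of ratio \<open>exp (- \<alpha>)\<close>, whose sum does not depend on
  \<open>w\<close>.\<close>

lemma hoelder_birkhoff_sum_bounded:
  assumes "hoelder A E \<alpha> f" "\<alpha> > 0"
  obtains M where "M > 0"
    "\<And>w \<tau>1 \<tau>2. \<tau>1 \<in> cylinder A E w \<Longrightarrow> \<tau>2 \<in> cylinder A E w \<Longrightarrow>
       \<bar>birkhoff_sum f (length w) \<tau>1 - birkhoff_sum f (length w) \<tau>2\<bar> \<le> M"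
proof -
  obtain C0 where C0: "\<And>n \<omega> \<tau>. n \<ge> 1 \<Longrightarrow> \<omega> \<in> inf_words A E \<Longrightarrow> \<tau> \<in> inf_words A E \<Longrightarrow>
      meet_length \<omega> \<tau> \<ge> enat n \<Longrightarrow> \<bar>f \<omega> - f \<tau>\<bar> * exp (\<alpha> * (real n - 1)) \<le> C0"
    using assms(1) unfolding hoelder_def bdd_above_def by blast
  define C where "C = max C0 1"
  define x where "x = exp (- \<alpha>)"
  have x: "0 < x" "x < 1" using assms(2) by (auto simp: x_def)
  have C: "C > 0" by (simp add: C_def)
  have step: "\<bar>f \<omega> - f \<tau>\<bar> \<le> C * x ^ n"
    if "\<omega> \<in> inf_words A E" "\<tau> \<in> inf_words A E" "stake (Suc n) \<omega> = stake (Suc n) \<tau>" for n \<omega> \<tau>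
  proof -
    have "meet_length \<omega> \<tau> \<ge> enat (Suc n)"
      unfolding meet_length_def using that(3) by (intro SUP_upper) auto
    from C0[OF _ that(1,2) this] have "\<bar>f \<omega> - f \<tau>\<bar> * exp (\<alpha> * real n) \<le> C"
      by (simp add: C_def)
    moreover have "x ^ n = inverse (exp (\<alpha> * real n))"
      by (simp add: x_def exp_of_nat2_mult exp_minus power_inverse)
    ultimately show ?thesis by (simp add: divide_inverse[symmetric] le_divide_eq)
  qed
  show ?thesis
  proof
    show "C / (1 - x) > 0" using x C by simp
    fix w \<tau>1 \<tau>2 assume \<tau>: "\<tau>1 \<in> cylinder A E w" "\<tau>2 \<in> cylinder A E w"
    let ?n = "length w"
    have "\<bar>birkhoff_sum f ?n \<tau>1 - birkhoff_sum f ?n \<tau>2\<bar> \<le>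
        (\<Sum>j<?n. \<bar>f (sdrop j \<tau>1) - f (sdrop j \<tau>2)\<bar>)"
      by (simp add: birkhoff_sum_def sum_subtractf[symmetric] sum_abs)
    \<comment> \<open>Agreement on \<open>k\<close> letters gives decay of exponent
      \<open>k - 1\<close>, as in the definition of \<open>hoelder\<close>; hence
      \<open>Suc j\<close> rather than \<open>j\<close>.\<close>
    also have "\<dots> \<le> (\<Sum>j<?n. C * x ^ (?n - Suc j))"
    proof (rule sum_mono)
      fix j assume "j \<in> {..<?n}"
      then have "?n - j = Suc (?n - Suc j)" by auto
      moreover have "stake (?n - j) (sdrop j \<tau>1) = stake (?n - j) (sdrop j \<tau>2)"
        using \<tau> by (simp add: cylinder_def drop_stake[symmetric])
      ultimately show "\<bar>f (sdrop j \<tau>1) - f (sdrop j \<tau>2)\<bar> \<le> C * x ^ (?n - Suc j)"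
        using \<tau> by (intro step) (auto simp: cylinder_def sdrop_inf_words)
    qed
    also have "\<dots> = C * (\<Sum>j<?n. x ^ j)"
      using sum.nat_diff_reindex[of "\<lambda>j. x ^ j" ?n] by (simp add: sum_distrib_left[symmetric])
    also have "\<dots> \<le> C * (1 / (1 - x))"
      using x C by (intro mult_left_mono) (auto simp: sum_gp_strict field_simps)
    finally show "\<bar>birkhoff_sum f ?n \<tau>1 - birkhoff_sum f ?n \<tau>2\<bar> \<le> C / (1 - x)" by simp
  qed
qed

text \<open>The uniform Hoelder bound shows that the set of admissible constants is nonempty, so its
  real infimum is meaningful. A bound valid for every member passes to the infimum.\<close>

lemma birkhoff_sum_distortion:
  assumes "hoelder A E \<alpha> f" "\<alpha> > 0"
  shows "distortion A E f \<ge> 0"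
    and "\<tau>1 \<in> cylinder A E w \<Longrightarrow> \<tau>2 \<in> cylinder A E w \<Longrightarrow>
      birkhoff_sum f (length w) \<tau>1 \<le> distortion A E f + birkhoff_sum f (length w) \<tau>2"
proof -
  define S where "S = {M. M > 0 \<and>
     (\<forall>n\<ge>1. \<forall>\<rho>\<in>words A E n. \<forall>\<omega>\<in>inf_words A E. \<forall>\<tau>\<in>inf_words A E.
        \<rho> @- \<omega> \<in> inf_words A E \<longrightarrow> \<rho> @- \<tau> \<in> inf_words A E \<longrightarrow>
        \<bar>birkhoff_sum f n (\<rho> @- \<omega>) - birkhoff_sum f n (\<rho> @- \<tau>)\<bar> \<le> M)}"
  obtain M where M: "M > 0" "\<And>w \<tau>1 \<tau>2. \<tau>1 \<in> cylinder A E w \<Longrightarrow> \<tau>2 \<in> cylinder A E w \<Longrightarrow>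
       \<bar>birkhoff_sum f (length w) \<tau>1 - birkhoff_sum f (length w) \<tau>2\<bar> \<le> M"
    using hoelder_birkhoff_sum_bounded[OF assms] by blast
  have "M \<in> S"
    unfolding S_def using M by (auto simp: words_eq cylinder_shift)
  then have ne: "S \<noteq> {}" by blast
  have L: "distortion A E f = Inf S"
    by (simp add: distortion_def S_def)
  show nonneg: "distortion A E f \<ge> 0"
    unfolding L using ne by (rule cInf_greatest) (auto simp: S_def)
  assume \<tau>: "\<tau>1 \<in> cylinder A E w" "\<tau>2 \<in> cylinder A E w"
  show "birkhoff_sum f (length w) \<tau>1 \<le> distortion A E f + birkhoff_sum f (length w) \<tau>2"
  \<comment> \<open>The definition of \<open>distortion\<close> speaks of words of length at least 1
    only; for the empty word both Birkhoff sums are 0.\<close>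
  proof (cases "w = []")
    case True
    then show ?thesis using nonneg by (simp add: birkhoff_sum_def)
  next
    case False
    have "birkhoff_sum f (length w) \<tau>1 - birkhoff_sum f (length w) \<tau>2 \<le> m" if "m \<in> S" for m
    proof -
      let ?r = "sdrop (length w)"
      have "\<tau>1 = w @- ?r \<tau>1" "\<tau>2 = w @- ?r \<tau>2" "\<tau>1 \<in> inf_words A E" "\<tau>2 \<in> inf_words A E"
        "w \<in> words A E (length w)"
        using \<tau> by (auto elim!: cylinderE simp: words_iff_fin_words)
      moreover have "?r \<tau>1 \<in> inf_words A E" "?r \<tau>2 \<in> inf_words A E"
        using calculation by (auto intro: sdrop_inf_words)
      moreover have "length w \<ge> 1" using False by (cases w) auto
      ultimately have "\<bar>birkhoff_sum f (length w) \<tau>1 - birkhoff_sum f (length w) \<tau>2\<bar> \<le> m"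
        using that unfolding S_def by (metis (no_types, lifting) mem_Collect_eq)
      then show ?thesis by linarith
    qed
    then have "birkhoff_sum f (length w) \<tau>1 - birkhoff_sum f (length w) \<tau>2 \<le> Inf S"
      using ne by (intro cInf_greatest) auto
    then show ?thesis by (simp add: L)
  qed
qed

section \<open>Infinite extensions of admissible words\<close>

text \<open>Linking \<open>i\<close> to itself shows that every letter has a successor in
  \<open>F\<close>; iterating a choice of successors gives the infinite word.\<close>

lemma finitely_irreducible_inf_word:
  assumes "finitely_irreducible A F" "i \<in> F"
  obtains \<tau> where "\<tau> \<in> inf_words A F" "shd \<tau> = i"
proof -
  obtain \<Lambda> where "\<forall>i\<in>F. \<forall>j\<in>F. \<exists>w\<in>\<Lambda>. [i] @ w @ [j] \<in> fin_words A F"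
    using assms(1) by (auto simp: finitely_irreducible_def witnesses_irreducibility_def)
  then have loop: "\<exists>w. [i] @ w @ [i] \<in> fin_words A F" if "i \<in> F" for i
    using that by metis
  have "\<exists>j\<in>F. A i j = 1" if i: "i \<in> F" for i
  proof -
    obtain w where w: "[i] @ w @ [i] \<in> fin_words A F"
      using loop[OF i] ..
    then have "w @ [i] \<in> fin_words A F" "A i (hd (w @ [i])) = 1"
      using fin_words_append[of "[i]" "w @ [i]" A F] by simp_all
    moreover from this have "hd (w @ [i]) \<in> F"
      using hd_in_set[of "w @ [i]"] by (auto simp: fin_words_eq)
    ultimately show ?thesis by blast
  qed
  then obtain nx where nx: "\<And>i. i \<in> F \<Longrightarrow> nx i \<in> F \<and> A i (nx i) = 1" by metis
  have F: "(nx ^^ k) i \<in> F" for k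
    using assms(2) nx by (induction k) auto
  have "siterate nx i \<in> inf_words A F"
    using F nx by (auto simp: inf_words_def streams_iff_snth simp del: snth.simps)
  then show ?thesis using that[of "siterate nx i"] by simp
qed

text \<open>An infinite word starting with the last letter of \<open>w\<close> is glued to
  \<open>w\<close> along that shared letter, which is why its head is dropped.\<close>

lemma cylinder_nonempty:
  assumes "finitely_irreducible A F" "F \<noteq> {}" "w \<in> fin_words A F"
  shows "cylinder A F w \<noteq> {}"
proof (cases "w = []")
  case True
  obtain i where "i \<in> F" using assms(2) by blast
  then obtain \<tau> where "\<tau> \<in> inf_words A F"
    using finitely_irreducible_inf_word[OF assms(1)] by blast
  with True show ?thesis by (auto simp: cylinder_def)
next
  case False
  then have "last w \<in> F" using assms(3) by (auto simp: fin_words_eq)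
  then obtain \<tau> where \<tau>: "\<tau> \<in> inf_words A F" "shd \<tau> = last w"
    using finitely_irreducible_inf_word[OF assms(1)] by blast
  have "last w ## stl \<tau> \<in> inf_words A F"
    using \<tau> by (metis stream.collapse)
  then have "w @- stl \<tau> \<in> inf_words A F"
    using False assms(3) by (simp add: inf_words_SCons inf_words_shift)
  then show ?thesis using cylinder_shift by blast
qed

section \<open>Consequences of bounded distortion for cylinder weights and
  \<open>kappa\<close>\<close>

lemma cyl_weight_distortion:
  assumes "hoelder A E \<alpha> f" "\<alpha> > 0" "\<tau> \<in> cylinder A E w"
  shows "cyl_weight A E f w \<le>
    ennreal (exp (distortion A E f)) * ennreal (exp (birkhoff_sum f (length w) \<tau>))"
  unfolding cyl_weight_def
  using birkhoff_sum_distortion(2)[OF assms(1,2) _ assms(3)]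
  by (intro SUP_least) (simp add: ennreal_mult[symmetric] exp_add[symmetric])

lemma cyl_weight_finite:
  assumes "hoelder A E \<alpha> f" "\<alpha> > 0"
  shows "cyl_weight A E f w < \<infinity>"
proof (cases "cylinder A E w = {}")
  case True
  then show ?thesis by (simp add: cyl_weight_def bot_ennreal)
next
  case False
  then obtain \<tau> where "\<tau> \<in> cylinder A E w" by blast
  from cyl_weight_distortion[OF assms this] show ?thesis
    by (rule le_less_trans) (simp add: ennreal_mult[symmetric])
qed

lemma kappa_le:
  assumes "finite \<Lambda>" "w \<in> \<Lambda>" "\<tau> \<in> cylinder A E w"
  shows "kappa A E \<Lambda> f \<le> exp (birkhoff_sum f (length w) \<tau>)"
proof -
  have "kappa A E \<Lambda> f \<le> (INF \<tau>\<in>cylinder A E w. exp (birkhoff_sum f (length w) \<tau>))"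
    unfolding kappa_def using assms by (intro Min_le) auto
  also have "\<dots> \<le> exp (birkhoff_sum f (length w) \<tau>)"
    using assms(3) by (intro cINF_lower bdd_belowI2[of _ 0]) auto
  finally show ?thesis .
qed

text \<open>By bounded distortion, one point of a cylinder bounds the exponential from below on the
  whole cylinder; then the minimum is over finitely many positive numbers.\<close>

lemma kappa_pos:
  assumes "finite \<Lambda>" "\<Lambda> \<noteq> {}" "\<And>w. w \<in> \<Lambda> \<Longrightarrow> cylinder A E w \<noteq> {}"
    and f: "hoelder A E \<alpha> f" "\<alpha> > 0"
  shows "kappa A E \<Lambda> f > 0"
proof -
  have "(INF \<tau>\<in>cylinder A E w. exp (birkhoff_sum f (length w) \<tau>)) > 0" if w: "w \<in> \<Lambda>" for w
  proof -
    obtain \<tau>0 where \<tau>0: "\<tau>0 \<in> cylinder A E w" using assms(3)[OF w] by blast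
    have "exp (birkhoff_sum f (length w) \<tau>0 - distortion A E f) \<le> exp (birkhoff_sum f (length w) \<tau>)"
      if "\<tau> \<in> cylinder A E w" for \<tau>
      using birkhoff_sum_distortion(2)[OF f \<tau>0 that] by simp
    then have "exp (birkhoff_sum f (length w) \<tau>0 - distortion A E f) \<le>
        (INF \<tau>\<in>cylinder A E w. exp (birkhoff_sum f (length w) \<tau>))"
      using assms(3)[OF w] by (intro cINF_greatest) auto
    then show ?thesis by (rule less_le_trans[OF exp_gt_zero])
  qed
  then show ?thesis
    unfolding kappa_def using assms(1,2) by (subst Min_gr_iff) auto
qed

section \<open>Finiteness of the partition functions\<close>

lemma partition_fun_0_le: "partition_fun A F f 0 \<le> 1"
proof -
  have "words A F 0 = {[]}" by (auto simp: words_eq)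
  then show ?thesis by (simp add: partition_fun_eq cyl_weight_Nil_le)
qed

lemma partition_fun_power_le: "partition_fun A F f n \<le> partition_fun A F f 1 ^ n"
proof (induction n)
  case 0
  then show ?case by (simp add: partition_fun_0_le)
next
  case (Suc n)
  have "partition_fun A F f (Suc n) \<le> partition_fun A F f 1 * partition_fun A F f n"
    using partition_fun_submultiplicative[of A F f 1 n] by simp
  also have "\<dots> \<le> partition_fun A F f 1 * partition_fun A F f 1 ^ n"
    using Suc by (intro mult_left_mono) auto
  finally show ?case by simp
qed

text \<open>Each letter \<open>i\<close> is prolonged to a word of length \<open>n\<close> that
  follows a linking word towards a fixed letter \<open>j\<close> and then a fixed infinite word. The
  first letter makes this injective, and only finitely many continuations occur, so their Birkhoff
  sums have a common lower bound.\<close>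

lemma partition_fun_1_le:
  assumes "F \<subseteq> E" "finitely_irreducible A F" "F \<noteq> {}" and f: "hoelder A E \<alpha> f" "\<alpha> > 0" and "n \<ge> 1"
  obtains C :: real where "partition_fun A F f 1 \<le> ennreal C * partition_fun A F f n"
proof -
  obtain \<Lambda> where \<Lambda>: "finite \<Lambda>" "\<forall>i\<in>F. \<forall>j\<in>F. \<exists>w\<in>\<Lambda>. [i] @ w @ [j] \<in> fin_words A F"
    using assms(2) by (auto simp: finitely_irreducible_def witnesses_irreducibility_def)
  obtain j where j: "j \<in> F" using assms(3) by blast
  obtain \<tau> where \<tau>: "\<tau> \<in> inf_words A F" "shd \<tau> = j"
    using finitely_irreducible_inf_word[OF assms(2) j] by blast
  obtain l where l: "\<And>i. i \<in> F \<Longrightarrow> l i \<in> \<Lambda>" "\<And>i. i \<in> F \<Longrightarrow> [i] @ l i @ [j] \<in> fin_words A F"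
    using bchoice[of F "\<lambda>i w. w \<in> \<Lambda> \<and> [i] @ w @ [j] \<in> fin_words A F"] \<Lambda>(2) j by blast
  define x where "x i = [i] @- l i @- \<tau>" for i
  have x: "x i \<in> inf_words A F" if "i \<in> F" for i
    using l(2)[OF that] \<tau> inf_words_shift[of "[i] @ l i" \<tau> A F]
      fin_words_append[of "[i] @ l i" "[j]" A F] by (simp add: x_def)
  \<comment> \<open>The minimum runs over all of \<Lambda>, including words that cannot precede
    \<tau>. This is harmless, since only a lower bound for the words \<open>l i\<close> is
    wanted.\<close>
  define c where "c = Min ((\<lambda>w. birkhoff_sum f (n - 1) (w @- \<tau>)) ` \<Lambda>)"
  have S: "birkhoff_sum f n (x i) \<ge> birkhoff_sum f 1 (x i) + c" if "i \<in> F" for i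
  proof -
    have "birkhoff_sum f n (x i) = birkhoff_sum f 1 (x i) + birkhoff_sum f (n - 1) (l i @- \<tau>)"
      using birkhoff_sum_add[of f 1 "n - 1" "x i"] \<open>n \<ge> 1\<close> by (simp add: x_def)
    moreover have "c \<le> birkhoff_sum f (n - 1) (l i @- \<tau>)"
      unfolding c_def using \<Lambda>(1) l(1)[OF that] by (intro Min_le) auto
    ultimately show ?thesis by simp
  qed
  define D where "D = exp (distortion A E f - c)"
  have le: "cyl_weight A F f [i] \<le> ennreal D * cyl_weight A F f (stake n (x i))" if i: "i \<in> F" for i
  proof -
    have "x i \<in> cylinder A E [i]"
      using x[OF i] inf_words_mono[OF assms(1)] by (auto simp: cylinder_def x_def)
    from cyl_weight_distortion[OF f this]
    have "cyl_weight A E f [i] \<le> ennreal (exp (distortion A E f + birkhoff_sum f 1 (x i)))"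
      by (simp add: ennreal_mult exp_add)
    also have "\<dots> \<le> ennreal D * ennreal (exp (birkhoff_sum f n (x i)))"
      using S[OF i] by (simp add: D_def ennreal_mult[symmetric] exp_add[symmetric])
    also have "\<dots> \<le> ennreal D * cyl_weight A F f (stake n (x i))"
      using cyl_weight_upper[of "x i" A F "stake n (x i)" f] x[OF i]
      by (intro mult_left_mono) (auto simp: cylinder_def)
    finally show ?thesis using cyl_weight_mono[OF assms(1)] order.trans by blast
  qed
  have "partition_fun A F f 1 \<le> ennreal D * partition_fun A F f n"
    unfolding partition_fun_eq
  proof (rule infsum_ennreal_leI)
    fix X assume X: "finite X" "X \<subseteq> words A F 1"
    have X1: "\<exists>i\<in>F. w = [i]" if "w \<in> X" for w
      using that X(2) by (auto simp: words_eq length_Suc_conv)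
    have hd_x: "hd (stake n (x i)) = i" for i
      using \<open>n \<ge> 1\<close> by (cases n) (auto simp: x_def)
    have "sum (cyl_weight A F f) X \<le> (\<Sum>w\<in>X. ennreal D * cyl_weight A F f (stake n (x (hd w))))"
      using X1 le by (intro sum_mono) fastforce
    also have "\<dots> = ennreal D * (\<Sum>w\<in>X. cyl_weight A F f (stake n (x (hd w))))"
      by (simp add: sum_distrib_left)
    also have "\<dots> \<le> ennreal D * infsum (cyl_weight A F f) (words A F n)"
    proof (intro mult_left_mono sum_image_le_infsum[OF X(1)])
      show "inj_on (\<lambda>w. stake n (x (hd w))) X"
        by (rule inj_onI) (metis X1 hd_x list.sel(1))
      show "(\<lambda>w. stake n (x (hd w))) ` X \<subseteq> words A F n"
        using X1 x stake_words by fastforce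
    qed simp
    finally show "sum (cyl_weight A F f) X \<le> \<dots>" .
  qed
  with that show ?thesis by blast
qed

text \<open>If the first partition function were infinite, so would be all with
  \<open>n \<ge> 1\<close>, and the pressure with them. Submultiplicativity then spreads finiteness
  from \<open>n = 1\<close> to all \<open>n\<close>.\<close>

lemma partition_fun_finite:
  assumes "F \<subseteq> E" "finitely_irreducible A F" and f: "hoelder A E \<alpha> f" "\<alpha> > 0"
    and P: "pressure A F f < \<infinity>"
  shows "partition_fun A F f n < \<infinity>"
proof -
  have "partition_fun A F f 1 \<noteq> \<infinity>"
  proof
    assume inf: "partition_fun A F f 1 = \<infinity>"
    then have "F \<noteq> {}"
      by (intro notI) (simp add: partition_fun_eq words_eq)
    have "partition_fun A F f n = \<infinity>" if n: "n \<ge> 1" for n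
    proof -
      obtain C :: real where "partition_fun A F f 1 \<le> ennreal C * partition_fun A F f n"
        using partition_fun_1_le[OF assms(1,2) \<open>F \<noteq> {}\<close> f n] by blast
      with inf show ?thesis
        by (auto simp: top_unique ennreal_mult_eq_top_iff)
    qed
    then have "\<forall>\<^sub>F n in sequentially. \<infinity> = ereal (1 / real n) * elog (partition_fun A F f n)"
      by (intro eventually_sequentiallyI[of 1]) (simp add: elog_def)
    then have "(\<lambda>n. ereal (1 / real n) * elog (partition_fun A F f n)) \<longlonglongrightarrow> \<infinity>"
      by (rule Lim_transform_eventually[OF tendsto_const])
    then have "pressure A F f = \<infinity>"
      unfolding pressure_def by (rule limI)
    with P show False by simp
  qed
  then have "partition_fun A F f 1 ^ n < \<infinity>"
    by (simp add: less_top[symmetric] power_eq_top_ennreal)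
  with partition_fun_power_le show ?thesis by (rule le_less_trans)
qed

section \<open>Linking words\<close>

text \<open>Grouping words by length leaves a geometric series of ratio
  \<open>q0 / q < 1\<close>.\<close>

lemma weighted_fin_words_sum_finite:
  assumes "0 < q0" "q0 < q" and Z: "\<And>n. partition_fun A F f n \<le> ennreal (C * q0 ^ n)" and "C \<ge> 0"
  shows "infsum (\<lambda>v. cyl_weight A F f v * ennreal (inverse q ^ length v)) (fin_words A F) < \<infinity>"
proof -
  define t where "t = q0 * inverse q"
  have t: "0 \<le> t" "t < 1" using assms(1,2) by (auto simp: t_def field_simps)
  let ?G = "\<lambda>v. cyl_weight A F f v * ennreal (inverse q ^ length v)"
  have "infsum ?G (fin_words A F) \<le> ennreal (\<Sum>n. C * t ^ n)"
  proof (rule infsum_ennreal_leI)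
    fix X assume X: "finite X" "X \<subseteq> fin_words A F"
    have "sum ?G X = (\<Sum>n\<in>length ` X. \<Sum>v\<in>{v\<in>X. length v = n}. ?G v)"
      by (rule sum.image_gen[OF X(1)])
    also have "\<dots> \<le> (\<Sum>n\<in>length ` X. ennreal (C * t ^ n))"
    proof (rule sum_mono)
      fix n
      have "(\<Sum>v\<in>{v\<in>X. length v = n}. ?G v) =
          (\<Sum>v\<in>{v\<in>X. length v = n}. cyl_weight A F f v) * ennreal (inverse q ^ n)"
        by (simp add: sum_distrib_right)
      also have "\<dots> \<le> partition_fun A F f n * ennreal (inverse q ^ n)"
        unfolding partition_fun_eq using X
        by (intro mult_right_mono infsum_ennreal_finite_le) (auto simp: words_iff_fin_words)
      also have "\<dots> \<le> ennreal (C * q0 ^ n) * ennreal (inverse q ^ n)"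
        using Z by (intro mult_right_mono) auto
      also have "\<dots> = ennreal (C * t ^ n)"
        using assms by (simp add: t_def ennreal_mult[symmetric] power_mult_distrib mult.assoc)
      finally show "(\<Sum>v\<in>{v\<in>X. length v = n}. ?G v) \<le> ennreal (C * t ^ n)" .
    qed
    also have "\<dots> = ennreal (\<Sum>n\<in>length ` X. C * t ^ n)"
      using t \<open>C \<ge> 0\<close> by (intro sum_ennreal) auto
    also have "\<dots> \<le> ennreal (\<Sum>n. C * t ^ n)"
      using t \<open>C \<ge> 0\<close> X(1)
      by (intro ennreal_leI sum_le_suminf summable_mult summable_geometric) auto
    finally show "sum ?G X \<le> \<dots>" .
  qed
  then show ?thesis by (rule le_less_trans) simp
qed

text \<open>A point of the cylinder of \<open>v\<close> over \<open>F\<close> is prefixed by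
  \<open>u @ l\<close>. The factor from \<open>l\<close> is at least \<open>kappa\<close>, and the
  one from \<open>u\<close> is within \<open>exp (distortion A E f)\<close> of its supremum over the
  full shift. This is where weights over \<open>E\<close> become controlled by weights over
  \<open>F\<close>.\<close>

lemma cyl_weight_linked:
  assumes "F \<subseteq> E" and f: "hoelder A E \<alpha> f" "\<alpha> > 0" and "finite \<Lambda>" "l \<in> \<Lambda>"
    and ulv: "u @ l @ v \<in> fin_words A F" "v \<noteq> []"
  shows "ennreal (kappa A E \<Lambda> f) * cyl_weight A E f u * cyl_weight A F f v \<le>
    ennreal (exp (distortion A E f)) * cyl_weight A F f (u @ l @ v)"
  unfolding cyl_weight_def[of A F f v] SUP_mult_left_ennreal
proof (rule SUP_least)
  fix \<tau> assume \<tau>: "\<tau> \<in> cylinder A F v"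
  let ?e = "\<lambda>w \<tau>. ennreal (exp (birkhoff_sum f (length w) \<tau>))"
  let ?D = "ennreal (exp (distortion A E f))"
  have v: "\<tau> = v @- sdrop (length v) \<tau>" and "v @- sdrop (length v) \<tau> \<in> inf_words A F"
    using \<tau> by (auto elim!: cylinderE)
  \<comment> \<open>As \<open>v\<close> is nonempty, the transition out of \<open>u @ l @ v\<close>
    is the one out of \<open>v\<close>, which \<tau> already satisfies.\<close>
  then have "(u @ l @ v) @- sdrop (length v) \<tau> \<in> inf_words A F"
    unfolding inf_words_shift using ulv by simp
  with v have F: "(u @ l) @- \<tau> \<in> cylinder A F (u @ l @ v)"
    using cylinder_shift[of "u @ l @ v" "sdrop (length v) \<tau>" A F] by simp
  then have E: "(u @ l) @- \<tau> \<in> cylinder A E (u @ l @ v)"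
    using inf_words_mono[OF assms(1)] by (auto simp: cylinder_def)
  then have u: "(u @ l) @- \<tau> \<in> cylinder A E u" and l: "l @- \<tau> \<in> cylinder A E l"
    by (simp_all add: cylinder_append sdrop_shift)
  have "ennreal (kappa A E \<Lambda> f) * cyl_weight A E f u * ?e v \<tau> \<le>
      ?e l (l @- \<tau>) * (?D * ?e u ((u @ l) @- \<tau>)) * ?e v \<tau>"
    using kappa_le[OF \<open>finite \<Lambda>\<close> \<open>l \<in> \<Lambda>\<close> l] cyl_weight_distortion[OF f u]
    by (intro mult_mono ennreal_leI) auto
  also have "\<dots> = ?D * ?e (u @ l @ v) ((u @ l) @- \<tau>)"
  proof -
    have "birkhoff_sum f (length (u @ l @ v)) ((u @ l) @- \<tau>) = birkhoff_sum f (length u) ((u @ l) @- \<tau>) +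
        (birkhoff_sum f (length l) (l @- \<tau>) + birkhoff_sum f (length v) \<tau>)"
      by (simp add: birkhoff_sum_add sdrop_shift)
    then show ?thesis
      by (simp only: exp_add ennreal_mult exp_ge_zero mult_nonneg_nonneg mult_ac)
  qed
  also have "\<dots> \<le> ?D * cyl_weight A F f (u @ l @ v)"
    by (intro mult_left_mono cyl_weight_upper F) simp
  finally show "ennreal (kappa A E \<Lambda> f) * cyl_weight A E f u * ?e v \<tau> \<le>
      ?D * cyl_weight A F f (u @ l @ v)" .
qed

lemma linking_word:
  assumes "witnesses_irreducibility A F \<Lambda>" "u \<in> fin_words A F" "v \<in> fin_words A F" "v \<noteq> []"
  shows "\<exists>l\<in>\<Lambda>. u @ l @ v \<in> fin_words A F"
proof -
  \<comment> \<open>This is the last letter of \<open>u\<close>, or \<open>hd v\<close> when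
    \<open>u\<close> is empty, so that a linking word exists in that case too.\<close>
  define i where "i = last (hd v # u)"
  have "set (hd v # u) \<subseteq> F"
    using assms(2-4) hd_in_set[of v] by (auto simp: fin_words_eq)
  then have i: "i \<in> F"
    unfolding i_def using last_in_set[of "hd v # u"] by blast
  moreover have "hd v \<in> F"
    using assms(3,4) hd_in_set[of v] by (auto simp: fin_words_eq)
  ultimately obtain l where l: "l \<in> \<Lambda>" "[i] @ l @ [hd v] \<in> fin_words A F"
    using assms(1) unfolding witnesses_irreducibility_def by blast
  have "l @ v \<in> fin_words A F"
    using l(2) assms(3,4) fin_words_append[of "[i]" "l @ [hd v]" A F]
    by (auto simp: fin_words_append)
  moreover have "A i (hd (l @ v)) = 1"
    using l(2) assms(4) fin_words_append[of "[i]" "l @ [hd v]" A F] by (cases l) auto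
  ultimately have "u @ l @ v \<in> fin_words A F"
    using assms(2) by (subst fin_words_append) (auto simp: i_def)
  with l(1) show ?thesis by blast
qed

text \<open>The linking word \<open>l\<close> and the concatenation together determine
  \<open>u\<close> and \<open>v\<close>, because \<open>u\<close> has the fixed length
  \<open>m\<close>. Cancelling \<Phi> requires it to be finite, which the gap between
  \<open>q0\<close> and \<open>q\<close> provides, and nonzero, which a single letter of
  \<open>F\<close> provides.\<close>

lemma linked_words_sum_bound:
  assumes "F \<subseteq> E" "F \<noteq> {}" and f: "hoelder A E \<alpha> f" "\<alpha> > 0"
    and \<Lambda>: "witnesses_irreducibility A F \<Lambda>"
    and q: "0 < q0" "q0 < q" "q \<le> 1"
    and Z: "\<And>n. partition_fun A F f n \<le> ennreal (C * q0 ^ n)" and "C \<ge> 0"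
  shows "ennreal (kappa A E \<Lambda> f) * infsum (cyl_weight A E f) (words A F m) \<le>
    ennreal (real (card \<Lambda>) * exp (distortion A E f)) * ennreal (q ^ m)"
proof (rule infsum_ennreal_mult_leI)
  fix U assume U: "finite U" "U \<subseteq> words A F m"
  have fin\<Lambda>: "finite \<Lambda>" using \<Lambda> by (simp add: witnesses_irreducibility_def)
  let ?k = "ennreal (kappa A E \<Lambda> f)"
  let ?D = "ennreal (exp (distortion A E f))"
  define G where "G v = cyl_weight A F f v * ennreal (inverse q ^ length v)" for v
  define V where "V = fin_words A F - {[]}"
  define \<Phi> where "\<Phi> = infsum G V"
  have "\<Phi> \<le> infsum G (fin_words A F)"
    unfolding \<Phi>_def V_def by (rule infsum_ennreal_leI) (auto intro: infsum_ennreal_finite_le)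
  also have "\<dots> < \<infinity>"
    unfolding G_def using weighted_fin_words_sum_finite[OF q(1,2) Z \<open>C \<ge> 0\<close>] .
  finally have \<Phi>_fin: "\<Phi> < \<infinity>" .
  have "\<Phi> \<noteq> 0"
  proof -
    obtain i where i: "i \<in> F" using assms(2) by blast
    then have iV: "[i] \<in> V" by (auto simp: V_def fin_words_eq)
    have "finitely_irreducible A F" using \<Lambda> by (auto simp: finitely_irreducible_def)
    then obtain \<tau> where "\<tau> \<in> cylinder A F [i]"
      using cylinder_nonempty[of A F "[i]"] assms(2) iV by (auto simp: V_def)
    from cyl_weight_upper[OF this, of f] have "cyl_weight A F f [i] \<noteq> 0"
      by (auto simp: ennreal_eq_0_iff)
    then have "G [i] \<noteq> 0" using q by (simp add: G_def ennreal_eq_0_iff)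
    moreover have "G [i] \<le> \<Phi>"
      using infsum_ennreal_finite_le[of "{[i]}" V G] iV by (simp add: \<Phi>_def)
    ultimately show ?thesis by auto
  qed
  have "\<exists>l\<in>\<Lambda>. fst p @ l @ snd p \<in> fin_words A F" if "p \<in> words A F m \<times> V" for p
    by (rule linking_word[OF \<Lambda>]) (use that in \<open>auto simp: V_def words_iff_fin_words\<close>)
  then obtain l where l: "\<And>p. p \<in> words A F m \<times> V \<Longrightarrow> l p \<in> \<Lambda>"
      "\<And>p. p \<in> words A F m \<times> V \<Longrightarrow> fst p @ l p @ snd p \<in> fin_words A F"
    by metis
  define \<phi> where "\<phi> p = fst p @ l p @ snd p" for p
  let ?c = "?k * sum (cyl_weight A E f) U * ennreal (inverse q ^ m)"
  have "?c * \<Phi> \<le> ?D * of_nat (card \<Lambda>) * \<Phi>"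
    unfolding \<Phi>_def
  proof (rule infsum_ennreal_mult_leI)
    fix Y assume Y: "finite Y" "Y \<subseteq> V"
    have UY: "p \<in> words A F m \<times> V" if "p \<in> U \<times> Y" for p
      using that U(2) Y(2) by auto
    have "?c * sum G Y = (\<Sum>p\<in>U \<times> Y. ?k * cyl_weight A E f (fst p) * ennreal (inverse q ^ m) * G (snd p))"
      by (simp add: sum_distrib_left sum_distrib_right sum.cartesian_product case_prod_unfold mult_ac)
    also have "\<dots> \<le> (\<Sum>p\<in>U \<times> Y. ?D * G (\<phi> p))"
    proof (rule sum_mono)
      fix p assume "p \<in> U \<times> Y"
      note p = UY[OF this]
      obtain u v where uv: "p = (u, v)" by fastforce
      have len: "length u = m" "v \<noteq> []"
        using p uv by (auto simp: words_eq V_def)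
      let ?r = "\<lambda>n. ennreal (inverse q ^ n)"
      have "?k * cyl_weight A E f u * ?r m * G v =
          ?k * cyl_weight A E f u * cyl_weight A F f v * (?r m * ?r (length v))"
        by (simp add: G_def mult_ac)
      also have "\<dots> \<le> ?D * cyl_weight A F f (\<phi> p) * ?r (length (\<phi> p))"
      proof (rule mult_mono)
        show "?k * cyl_weight A E f u * cyl_weight A F f v \<le> ?D * cyl_weight A F f (\<phi> p)"
          unfolding \<phi>_def uv using l[OF p] len
          by (auto simp: uv intro!: cyl_weight_linked[OF assms(1) f fin\<Lambda>])
        \<comment> \<open>Since \<open>q \<le> 1\<close>, the extra letters of the linking word can
          only increase the power of \<open>inverse q\<close>.\<close>
        have "inverse q ^ (m + length v) \<le> inverse q ^ length (\<phi> p)"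
          using q len by (intro power_increasing) (auto simp: \<phi>_def uv one_le_inverse)
        then show "?r m * ?r (length v) \<le> ?r (length (\<phi> p))"
          using q by (simp add: ennreal_mult[symmetric] power_add[symmetric] ennreal_leI del: power_inverse)
      qed auto
      finally show "?k * cyl_weight A E f (fst p) * ?r m * G (snd p) \<le> ?D * G (\<phi> p)"
        by (simp add: uv G_def mult_ac)
    qed
    \<comment> \<open>The factor 1 is a function of the linking word; its sum over \<Lambda> is the
      multiplicity \<open>card \<Lambda>\<close>.\<close>
    also have "\<dots> = ?D * (\<Sum>p\<in>U \<times> Y. 1 * G (\<phi> p))"
      by (simp add: sum_distrib_left)
    also have "\<dots> \<le> ?D * (infsum (\<lambda>_. 1) \<Lambda> * infsum G V)"
    proof (intro mult_left_mono sum_prod_le_infsum_mult)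
      show "finite (U \<times> Y)" using U(1) Y(1) by simp
      show "l ` (U \<times> Y) \<subseteq> \<Lambda>" using l(1) UY by blast
      show "\<phi> ` (U \<times> Y) \<subseteq> V"
        using l(2) UY by (force simp: \<phi>_def V_def)
      show "inj_on (\<lambda>p. (l p, \<phi> p)) (U \<times> Y)"
      proof (rule inj_onI)
        fix p p' assume p: "p \<in> U \<times> Y" "p' \<in> U \<times> Y" "(l p, \<phi> p) = (l p', \<phi> p')"
        then have "length (fst p) = length (fst p')"
          using UY[OF p(1)] UY[OF p(2)] by (auto simp: words_eq)
        with p(3) show "p = p'"
          by (auto simp: \<phi>_def prod_eq_iff)
      qed
    qed simp
    finally show "?c * sum G Y \<le> ?D * of_nat (card \<Lambda>) * infsum G V"
      using fin\<Lambda> by (simp add: mult_ac)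
  qed
  then have "?c \<le> ?D * of_nat (card \<Lambda>)"
    using ennreal_mult_le_mult_iff[of \<Phi> ?c "?D * of_nat (card \<Lambda>)"] \<Phi>_fin \<open>\<Phi> \<noteq> 0\<close>
    by (simp add: mult.commute)
  then have "?c * ennreal (q ^ m) \<le> ?D * of_nat (card \<Lambda>) * ennreal (q ^ m)"
    by (intro mult_right_mono) auto
  moreover have "?c * ennreal (q ^ m) = ?k * sum (cyl_weight A E f) U"
    using q by (simp add: mult.assoc ennreal_mult[symmetric] power_mult_distrib[symmetric])
  moreover have "?D * of_nat (card \<Lambda>) = ennreal (real (card \<Lambda>) * exp (distortion A E f))"
    by (simp add: ennreal_mult ennreal_of_nat_eq_real_of_nat mult.commute)
  ultimately show "?k * sum (cyl_weight A E f) U \<le>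
      ennreal (real (card \<Lambda>) * exp (distortion A E f)) * ennreal (q ^ m)"
    by simp
qed

section \<open>Adjoining a letter\<close>

text \<open>Expand the \<open>n\<close> factors according to the first one from which
  \<open>c\<close> is chosen, at position \<open>m\<close>. This is the algebraic counterpart of
  cutting a word at its first letter outside \<open>F\<close>.\<close>

lemma power_add_first_passage:
  fixes q c :: "'a::comm_semiring_1"
  shows "(q + c) ^ n = q ^ n + (\<Sum>m<n. q ^ m * c * (q + c) ^ (n - Suc m))"
proof (induction n)
  case (Suc n)
  have "(q + c) ^ Suc n = c * (q + c) ^ n + q * (q + c) ^ n"
    by (simp add: algebra_simps)
  also have "q * (q + c) ^ n = q * (q ^ n + (\<Sum>m<n. q ^ m * c * (q + c) ^ (n - Suc m)))"
    by (rule arg_cong[OF Suc])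
  also have "\<dots> = q ^ Suc n + (\<Sum>m<n. q ^ Suc m * c * (q + c) ^ (n - Suc m))"
    by (simp add: distrib_left sum_distrib_left mult_ac)
  finally show ?case
    by (subst sum.lessThan_Suc_shift) (simp add: add_ac)
qed simp

text \<open>The first letter outside \<open>F\<close>, if any, can only be \<open>a\<close>. It is
  preceded by a word over \<open>F\<close> and followed by an arbitrary word over
  \<open>F \<union> {a}\<close>; the weights are submultiplicative under both cuts.\<close>

lemma infsum_words_insert_le:
  assumes "F \<subseteq> E" "a \<in> E"
  shows "infsum (cyl_weight A E f) (words A (F \<union> {a}) n) \<le>
    infsum (cyl_weight A E f) (words A F n) +
    (\<Sum>m<n. infsum (cyl_weight A E f) (words A F m) * cyl_weight A E f [a] *
       infsum (cyl_weight A E f) (words A (F \<union> {a}) (n - Suc m)))"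
    (is "_ \<le> ?W n + (\<Sum>m<n. ?W m * ?a * ?W' (n - Suc m))")
proof (rule infsum_ennreal_leI)
  fix X assume X: "finite X" "X \<subseteq> words A (F \<union> {a}) n"
  let ?w = "cyl_weight A E f"
  define pre where "pre = takeWhile (\<lambda>x. x \<in> F)"
  have pre_F: "set (pre w) \<subseteq> F" for w
    using set_takeWhileD by (fastforce simp: pre_def)
  have len: "length (pre w) \<le> n" if "w \<in> X" for w
    using that X(2) length_takeWhile_le[of "\<lambda>x. x \<in> F" w] by (auto simp: pre_def words_eq)
  have decomp: "w = pre w @ [a] @ drop (Suc (length (pre w))) w" if "w \<in> X" "length (pre w) < n" for w
  proof -
    have w: "length w = n" "set w \<subseteq> F \<union> {a}" using that X(2) by (auto simp: words_eq)
    have "w ! length (pre w) \<notin> F"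
      using nth_length_takeWhile[of "\<lambda>x. x \<in> F" w] that w by (simp add: pre_def)
    moreover have "w ! length (pre w) \<in> F \<union> {a}"
      using subsetD[OF w(2) nth_mem] w(1) that by simp
    ultimately have "w ! length (pre w) = a" by auto
    moreover have "take (length (pre w)) w = pre w"
      by (simp add: pre_def takeWhile_eq_take[symmetric])
    ultimately show ?thesis
      using id_take_nth_drop[of "length (pre w)" w] that w by simp
  qed
  \<comment> \<open>Grouping is by the length of the initial block over \<open>F\<close>; length
    \<open>n\<close> means that the whole word lies over \<open>F\<close>.\<close>
  have "sum ?w X = (\<Sum>m\<le>n. sum ?w {w \<in> X. length (pre w) = m})"
    using len X(1) by (intro sum.group[symmetric]) auto
  also have "\<dots> = sum ?w {w \<in> X. length (pre w) = n} + (\<Sum>m<n. sum ?w {w \<in> X. length (pre w) = m})"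
    by (simp add: lessThan_Suc_atMost[symmetric] add.commute)
  also have "\<dots> \<le> ?W n + (\<Sum>m<n. ?W m * ?a * ?W' (n - Suc m))"
  proof (intro add_mono sum_mono)
    have "w \<in> words A F n" if "w \<in> X" "length (pre w) = n" for w
    proof -
      have "w = pre w"
        using that X(2) takeWhile_eq_take[of "\<lambda>x. x \<in> F" w] by (auto simp: pre_def words_eq)
      with pre_F[of w] show ?thesis using that X(2) by (auto simp: words_eq)
    qed
    then show "sum ?w {w \<in> X. length (pre w) = n} \<le> ?W n"
      using X(1) by (intro infsum_ennreal_finite_le) auto
  next
    fix m assume "m \<in> {..<n}"
    then have m: "m < n" by simp
    let ?X = "{w \<in> X. length (pre w) = m}"
    let ?s = "drop (Suc m)"
    have D: "w = pre w @ [a] @ ?s w" if "w \<in> ?X" for w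
      using decomp[of w] that m by auto
    have "?w w \<le> ?a * (?w (pre w) * ?w (?s w))" if "w \<in> ?X" for w
    proof -
      have "?w w = ?w (pre w @ [a] @ ?s w)"
        using D[OF that] by (rule arg_cong)
      also have "\<dots> \<le> ?w (pre w) * (?a * ?w (?s w))"
        by (rule order.trans[OF cyl_weight_append_le]) (intro mult_left_mono cyl_weight_append_le; simp)
      finally show ?thesis by (simp add: mult_ac)
    qed
    then have "sum ?w ?X \<le> ?a * (\<Sum>w\<in>?X. ?w (pre w) * ?w (?s w))"
      unfolding sum_distrib_left by (rule sum_mono)
    also have "\<dots> \<le> ?a * (?W m * ?W' (n - Suc m))"
    proof (intro mult_left_mono sum_prod_le_infsum_mult)
      show "finite ?X" using X(1) by simp
      show "inj_on (\<lambda>w. (pre w, ?s w)) ?X"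
        by (rule inj_onI) (metis D prod.inject)
      have "pre w \<in> words A F m \<and> ?s w \<in> words A (F \<union> {a}) (n - Suc m)" if "w \<in> ?X" for w
      proof -
        have "w \<in> fin_words A (F \<union> {a})" "length w = n"
          using that X(2) by (auto simp: words_iff_fin_words)
        then have "pre w \<in> fin_words A (F \<union> {a})" "?s w \<in> fin_words A (F \<union> {a})" "length w = n"
          using D[OF that] fin_words_append[of "pre w" "[a] @ ?s w" A "F \<union> {a}"]
            fin_words_append[of "[a]" "?s w" A "F \<union> {a}"] by auto
        then show ?thesis
          using pre_F[of w] that by (auto simp: words_iff_fin_words fin_words_eq)
      qed
      then show "pre ` ?X \<subseteq> words A F m" "?s ` ?X \<subseteq> words A (F \<union> {a}) (n - Suc m)" by blast+
    qed simp
    finally show "sum ?w ?X \<le> ?W m * ?a * ?W' (n - Suc m)" by (simp add: mult_ac)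
  qed
  finally show "sum ?w X \<le> \<dots>" .
qed

text \<open>Inserting the bounds into the first-passage decomposition reproduces the first-passage
  expansion of the power. One \<open>K\<close> stays in front and the other joins the weight of
  \<open>[a]\<close>. For \<open>n = 0\<close> the hypothesis at \<open>m = 0\<close> is what
  counts.\<close>

lemma infsum_words_insert_bound:
  fixes K q :: ennreal
  assumes "F \<subseteq> E" "a \<in> E"
    and W: "\<And>m. infsum (cyl_weight A E f) (words A F m) \<le> K * q ^ m"
  shows "infsum (cyl_weight A E f) (words A (F \<union> {a}) n) \<le> K * (q + K * cyl_weight A E f [a]) ^ n"
proof (induction n rule: less_induct)
  case (less n)
  let ?c = "K * cyl_weight A E f [a]"
  have "infsum (cyl_weight A E f) (words A (F \<union> {a}) n) \<le>
      K * q ^ n + (\<Sum>m<n. K * q ^ m * cyl_weight A E f [a] * (K * (q + ?c) ^ (n - Suc m)))"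
    by (rule order.trans[OF infsum_words_insert_le[OF assms(1,2)]])
      (intro add_mono sum_mono mult_mono W less; simp)
  also have "\<dots> = K * (q ^ n + (\<Sum>m<n. q ^ m * ?c * (q + ?c) ^ (n - Suc m)))"
    by (simp add: distrib_left sum_distrib_left mult_ac)
  also have "\<dots> = K * (q + ?c) ^ n"
    by (rule arg_cong[OF power_add_first_passage[symmetric]])
  finally show ?case .
qed

section \<open>The geometric bound over \<open>F\<close> and the passage to the pressure\<close>

lemma words_sum_geometric_bound:
  assumes "infinite E" "finitely_irreducible A E" "F \<subseteq> E" "\<Lambda> \<noteq> {}"
    and \<Lambda>: "witnesses_irreducibility A F \<Lambda>"
    and f: "hoelder A E \<alpha> f" "\<alpha> > 0"
    and fin: "\<And>n. partition_fun A F f n < \<infinity>"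
    and r: "(\<lambda>n. root n (enn2real (partition_fun A F f n))) \<longlonglongrightarrow> r" "r \<ge> 0"
    and q: "r < q" "q \<le> 1"
  shows "infsum (cyl_weight A E f) (words A F m) \<le>
    ennreal (real (card \<Lambda>) * exp (distortion A E f) / kappa A E \<Lambda> f) * ennreal q ^ m"
\<comment> \<open>Without letters \<Phi> would vanish and could not be cancelled. Here \<Lambda>
  contains just the empty word, \<open>kappa\<close> is 1, and only \<open>m = 0\<close>
  contributes.\<close>
proof (cases "F = {}")
  case True
  then have \<Lambda>_eq: "\<Lambda> = {[]}"
    using \<Lambda> \<open>\<Lambda> \<noteq> {}\<close> by (auto simp: witnesses_irreducibility_def fin_words_eq)
  have "cylinder A E [] \<noteq> {}"
    using assms(1,2) by (intro cylinder_nonempty) (auto simp: fin_words_eq)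
  then have "kappa A E \<Lambda> f = 1"
    by (simp add: \<Lambda>_eq kappa_def birkhoff_sum_def)
  moreover have "distortion A E f \<ge> 0"
    by (rule birkhoff_sum_distortion(1)[OF f])
  ultimately show ?thesis
    using cyl_weight_Nil_le[of A E f]
    by (auto simp: True words_empty \<Lambda>_eq intro: order.trans)
next
  case False
  let ?k = "kappa A E \<Lambda> f" and ?X = "real (card \<Lambda>) * exp (distortion A E f)"
  obtain q0 where q0: "r < q0" "q0 < q" using q(1) dense by blast
  have pos: "q0 > 0" "q > 0" using q0 r(2) by auto
  obtain C where C: "C \<ge> 0" "\<And>n. enn2real (partition_fun A F f n) \<le> C * q0 ^ n"
    using root_tendsto_imp_geometric_bound[OF _ r(1) q0(1) pos(1)] by auto
  have "partition_fun A F f n \<le> ennreal (C * q0 ^ n)" for n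
    using C(2)[of n] fin[of n] by (metis ennreal_enn2real ennreal_leI infinity_ennreal_def)
  then have "ennreal ?k * infsum (cyl_weight A E f) (words A F m) \<le> ennreal ?X * ennreal (q ^ m)"
    using linked_words_sum_bound[OF \<open>F \<subseteq> E\<close> False f \<Lambda> pos(1) q0(2) q(2) _ C(1)] by blast
  then have *: "ennreal (1 / ?k) * (ennreal ?k * infsum (cyl_weight A E f) (words A F m)) \<le>
      ennreal (1 / ?k) * (ennreal ?X * ennreal (q ^ m))"
    by (intro mult_left_mono) auto
  have "cylinder A E w \<noteq> {}" if "w \<in> \<Lambda>" for w
    using that \<Lambda> fin_words_mono[OF \<open>F \<subseteq> E\<close>] assms(1,2)
    by (intro cylinder_nonempty) (auto simp: witnesses_irreducibility_def)
  then have k: "?k > 0"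
    using \<Lambda> \<open>\<Lambda> \<noteq> {}\<close> f by (intro kappa_pos) (auto simp: witnesses_irreducibility_def)
  have "ennreal (1 / ?k) * ennreal ?k = 1"
    using k by (simp add: ennreal_mult[symmetric])
  moreover have "ennreal (1 / ?k) * ennreal ?X = ennreal (?X / ?k)"
    using k by (simp add: ennreal_mult[symmetric])
  ultimately show ?thesis
    using * pos by (simp add: mult.assoc[symmetric] ennreal_power)
qed

theorem proposition2p5:
  fixes E F :: "'e set" and A :: "'e \<Rightarrow> 'e \<Rightarrow> nat" and \<Lambda> :: "'e list set"
    and \<alpha> :: real and a :: 'e and f :: "'e stream \<Rightarrow> real"
  assumes "countable E" and "infinite E"
    and "\<forall>i\<in>E. \<forall>j\<in>E. A i j \<in> {0, 1}"
    and "finitely_irreducible A E"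
    and "F \<subseteq> E" and "finitely_irreducible A F"
    and "witnesses_irreducibility A F \<Lambda>" and "\<Lambda> \<noteq> {}"
    and "\<alpha> > 0"
    and "a \<in> E"
    and "hoelder A E \<alpha> f"
    and "pressure A F f < 0"
  shows "eexp (pressure A (F \<union> {a}) f) \<le>
    eexp (pressure A F f)
      + ennreal (real (card \<Lambda>) * exp (distortion A E f) / kappa A E \<Lambda> f)
        * eexp (SUP \<tau>\<in>cylinder A E [a]. ereal (f \<tau>))"
proof -
  note f = \<open>hoelder A E \<alpha> f\<close> \<open>\<alpha> > 0\<close>
  define K where "K = real (card \<Lambda>) * exp (distortion A E f) / kappa A E \<Lambda> f"
  define Ea where "Ea = cyl_weight A E f [a]"
  have Ea: "eexp (SUP \<tau>\<in>cylinder A E [a]. ereal (f \<tau>)) = Ea"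
    by (simp add: Ea_def cyl_weight_def eexp_SUP birkhoff_sum_def)
  have "Ea < \<infinity>"
    unfolding Ea_def by (rule cyl_weight_finite[OF f])
  have "pressure A F f < \<infinity>" using assms(12) by (rule less_trans) simp
  then have fin: "partition_fun A F f n < \<infinity>" for n
    using partition_fun_finite[OF \<open>F \<subseteq> E\<close> \<open>finitely_irreducible A F\<close> f] by blast
  obtain r where r: "r \<ge> 0" "pressure A F f = elog (ennreal r)"
    "(\<lambda>n. root n (enn2real (partition_fun A F f n))) \<longlonglongrightarrow> r"
    using pressure_eq_elog[OF fin] by blast
  \<comment> \<open>Negative pressure leaves room for some \<open>q\<close> with
    \<open>r < q \<le> 1\<close>, the range in which the linking estimate holds.\<close>
  have "r < 1"
  proof (rule ccontr)
    assume "\<not> r < 1"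
    then have "pressure A F f \<ge> 0" by (simp add: r(2) elog_def)
    with assms(12) show False by simp
  qed
  have Z': "partition_fun A (F \<union> {a}) f n \<le> ennreal K * (ennreal q + ennreal K * Ea) ^ n"
    if q: "r < q" "q \<le> 1" for q n
  proof -
    have "partition_fun A (F \<union> {a}) f n \<le> infsum (cyl_weight A E f) (words A (F \<union> {a}) n)"
      unfolding partition_fun_eq
      using \<open>F \<subseteq> E\<close> \<open>a \<in> E\<close> by (intro infsum_mono cyl_weight_mono nonneg_summable_on_complete) auto
    also have "\<dots> \<le> ennreal K * (ennreal q + ennreal K * Ea) ^ n"
      unfolding K_def Ea_def
      by (intro infsum_words_insert_bound words_sum_geometric_bound[OF _ _ _ _ _ f fin r(3,1) q] assms)
    finally show ?thesis .
  qed
  have base_fin: "ennreal q + ennreal K * Ea < \<infinity>" for q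
    using \<open>Ea < \<infinity>\<close> by (simp add: ennreal_mult_less_top)
  \<comment> \<open>\<open>F \<union> {a}\<close> need not be finitely irreducible, so finiteness is
    read off the bound with \<open>q = 1\<close>.\<close>
  have "partition_fun A (F \<union> {a}) f n < \<infinity>" for n
    using Z'[OF \<open>r < 1\<close> order.refl, of n]
    by (rule le_less_trans)
      (use base_fin[of 1] in \<open>simp add: ennreal_mult_less_top power_less_top_ennreal\<close>)
  then obtain r' where r': "r' \<ge> 0" "pressure A (F \<union> {a}) f = elog (ennreal r')"
    "(\<lambda>n. root n (enn2real (partition_fun A (F \<union> {a}) f n))) \<longlonglongrightarrow> r'"
    using pressure_eq_elog[of A "F \<union> {a}" f] by blast
  have bound: "ennreal r' \<le> ennreal q + ennreal K * Ea" if q: "r < q" "q \<le> 1" for q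
  proof -
    define b where "b = enn2real (ennreal q + ennreal K * Ea)"
    have b: "b \<ge> 0" "ennreal q + ennreal K * Ea = ennreal b"
      using base_fin[of q] by (simp_all add: b_def)
    \<comment> \<open>\<open>M\<close> is positive and at least \<open>K\<close>, so
      \<open>root n M\<close> tends to 1 and the constant in front disappears in the limit.\<close>
    define M where "M = max K 1"
    have le: "root n (enn2real (partition_fun A (F \<union> {a}) f n)) \<le> root n M * b" if "n \<ge> 1" for n
    proof -
      have "partition_fun A (F \<union> {a}) f n \<le> ennreal K * ennreal b ^ n"
        using Z'[OF q, of n] by (simp only: b)
      also have "\<dots> \<le> ennreal (M * b ^ n)"
        using b(1) by (auto simp: M_def ennreal_mult ennreal_power intro!: mult_right_mono ennreal_leI)
      finally have "enn2real (partition_fun A (F \<union> {a}) f n) \<le> M * b ^ n"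
        using b(1) by (intro enn2real_leI) (auto simp: M_def)
      then have "root n (enn2real (partition_fun A (F \<union> {a}) f n)) \<le> root n (M * b ^ n)"
        using that by (intro real_root_le_mono) auto
      also have "\<dots> = root n M * b"
        using that b(1) by (simp add: real_root_mult real_root_power_cancel)
      finally show ?thesis .
    qed
    have "(\<lambda>n. root n M * b) \<longlonglongrightarrow> 1 * b"
      by (intro tendsto_intros LIMSEQ_root_const) (simp add: M_def)
    with r'(3) have "r' \<le> 1 * b"
      by (rule LIMSEQ_le) (use le in auto)
    then show ?thesis by (simp add: b(2) ennreal_leI)
  qed
  have "ennreal r' \<le> ennreal r + ennreal K * Ea"
  proof (rule ennreal_le_epsilon)
    fix e :: real assume "0 < e"
    \<comment> \<open>The cap at 1 keeps \<open>q\<close> in the permitted range while it stays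
      within \<open>e\<close> of \<open>r\<close>.\<close>
    define q where "q = min (r + e) 1"
    have q: "r < q" "q \<le> 1" "q \<le> r + e"
      using \<open>0 < e\<close> \<open>r < 1\<close> by (auto simp: q_def)
    have "ennreal q \<le> ennreal r + ennreal e"
      using q(3) r(1) \<open>0 < e\<close> by (simp add: ennreal_plus[symmetric] ennreal_leI del: ennreal_plus)
    then have "ennreal q + ennreal K * Ea \<le> ennreal r + ennreal e + ennreal K * Ea"
      by (rule add_right_mono)
    from order.trans[OF bound[OF q(1,2)] this]
    show "ennreal r' \<le> ennreal r + ennreal K * Ea + ennreal e"
      by (simp only: add_ac)
  qed
  then show ?thesis
    by (simp only: r(2) r'(2) eexp_elog Ea K_def)
qed

end
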